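(* Let $u\in H$, i.e. $u(t)=\sum_{n=0}^\infty a_n\frac{t^{q^n}}{D_n}$ with $a_n\in\overline{K}_c$ and $|a_n|\to 0$ as $n\to\infty$. Then $$a_n=\lim_{t\to 0}\frac{\Delta^{(n)}u(t)}{t^{q^n}},\qquad n=0,1,2,\ldots .$$
   Context: Let $\mathbf F_q$ be the finite field with $q=p^\gamma$ elements ($p$ prime, $\gamma\ge 1$), and let $K=\mathbf F_q((x))$ be the field of formal Laurent series over $\mathbf F_q$, with absolute value $|z|=q^{-n}$ for $z=\sum_{i=n}^\infty\zeta_i x^i$, $\zeta_i\in\mathbf F_q$, $\zeta_n\neq 0$ (and $|0|=0$). Let $\overline{K}_c$ be the completion of an algebraic closure of $K$, with the extended absolute value $|\cdot|$. Put $[i]=x^{q^i}-x$ for $i\ge 1$, $D_0=1$ and $D_i=[i]\,[i-1]^q\cdots[1]^{q^{i-1}}$ for $i\ge 1$; then $|D_n|=q^{-(q^n-1)/(q-1)}$. $H$ is the Banach space over $\overline{K}_c$ of all power series $u(t)=\sum_{n=0}^\infty a_n\frac{t^{q^n}}{D_n}$ with $a_n\in\overline{K}_c$, $|a_n|\to0$, with norm $\sup_n|a_n|$. Each such series defines a function on $\{t\in\overline{K}_c: |t|\le q^{-1/(q-1)}\}$. The difference operators $\Delta^{(n)}$ are defined by $\Delta^{(0)}=\mathrm{id}$ and $(\Delta^{(n)}u)(t)=(\Delta^{(n-1)}u)(xt)-x^{q^{n-1}}(\Delta^{(n-1)}u)(t)$ for $n\ge1$. The limit $t\to0$ is taken over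 $t\ne0$. *)

theory Defs
  imports
    "HOL-Analysis.Analysis"
    "HOL-Algebra.Algebraic_Closure_Type"
    "HOL-Computational_Algebra.Formal_Laurent_Series"
begin

definition fls_abs :: "'a::finite_field fls \<Rightarrow> real" where
  "fls_abs z = (if z = 0 then 0 else real CARD('a) powi (- fls_subdegree z))"

text \<open>
  The field \<open>'c\<close> with absolute value \<open>absv\<close> is a completion of the algebraic closure of the
  Laurent series field \<open>'a fls\<close>, \<open>emb\<close> being the inclusion of the algebraic closure; \<open>absv\<close> extends
  \<open>fls_abs\<close>. These conditions determine the field and its absolute value up to isometric
  isomorphism. Limits, infinite sums and closures in \<open>'c\<close> are the library's, taken for the metric
  \<open>dist a b = absv (a - b)\<close>; completeness is the class \<open>complete_space\<close>. The class provides no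
  relation between the metric and the field operations: this is the content of the assumptions.
\<close>

locale completed_algebraic_closure =
  fixes emb :: "'a::finite_field fls alg_closure \<Rightarrow> 'c::{field,complete_space}"
    and absv :: "'c \<Rightarrow> real"
  assumes emb_add: "emb (a + b) = emb a + emb b"
    and emb_mult: "emb (a * b) = emb a * emb b"
    and emb_one: "emb 1 = 1"
    and dist_eq_absv: "dist y z = absv (y - z)"
    and absv_mult: "absv (y * z) = absv y * absv z"
    and absv_ultrametric: "absv (y + z) \<le> max (absv y) (absv z)"
    and absv_extends: "absv (emb (to_ac f)) = fls_abs f"
    and emb_dense: "closure (range emb) = UNIV"

definition bracket :: "nat \<Rightarrow> 'c::field \<Rightarrow> nat \<Rightarrow> 'c" where
  "bracket q x i = x ^ (q ^ i) - x"

definition carlitz_D :: "nat \<Rightarrow> 'c::field \<Rightarrow> nat \<Rightarrow> 'c" where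
  "carlitz_D q x i = (\<Prod>j = 1..i. bracket q x j ^ (q ^ (i - j)))"

definition carlitz_disc :: "nat \<Rightarrow> ('c \<Rightarrow> real) \<Rightarrow> 'c set" where
  "carlitz_disc q absv = {t. absv t \<le> real q powr (- 1 / (real q - 1))}"

definition carlitz_series ::
    "nat \<Rightarrow> 'c \<Rightarrow> (nat \<Rightarrow> 'c) \<Rightarrow> 'c::{field,metric_space} \<Rightarrow> 'c" where
  "carlitz_series q x a t = (\<Sum>n. a n * (t ^ (q ^ n) / carlitz_D q x n))"

text \<open>
  \<open>in_H q x absv u a\<close>: the function \<open>u\<close> is the element of \<open>H\<close> with coefficients \<open>a\<close>. Only the
  values of \<open>u\<close> on the disc are constrained.
\<close>

definition in_H ::
    "nat \<Rightarrow> 'c \<Rightarrow> ('c \<Rightarrow> real) \<Rightarrow> ('c \<Rightarrow> 'c) \<Rightarrow> (nat \<Rightarrow> 'c::{field,metric_space}) \<Rightarrow> bool" where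
  "in_H q x absv u a \<longleftrightarrow>
     (\<lambda>n. absv (a n)) \<longlonglongrightarrow> 0 \<and> (\<forall>t \<in> carlitz_disc q absv. u t = carlitz_series q x a t)"

primrec Delta :: "nat \<Rightarrow> 'c::field \<Rightarrow> nat \<Rightarrow> ('c \<Rightarrow> 'c) \<Rightarrow> 'c \<Rightarrow> 'c" where
  "Delta q x 0 u = u"
| "Delta q x (Suc n) u = (\<lambda>t. Delta q x n u (x * t) - x ^ (q ^ n) * Delta q x n u t)"

end

theory Submission
  imports Defs
begin

text \<open>
  The operator \<open>\<Delta>\<^sup>(\<^sup>n\<^sup>)\<close> multiplies \<open>t ^ (q ^ m)\<close> by \<open>\<Prod>j<n. x ^ (q ^ m) - x ^ (q ^ j)\<close>, which vanishes
  for \<open>m < n\<close> and, by the Frobenius identity, equals \<open>D\<^sub>n\<close> for \<open>m = n\<close>. With \<open>r\<close> the radius of the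
  disc, \<open>r ^ (q - 1) = 1 / q\<close>, so that for \<open>m \<ge> n\<close> the product has absolute value \<open>r ^ (q ^ n - 1)\<close>.
  After division by \<open>t ^ (q ^ n)\<close> the \<open>m\<close>-th term of the series thus has absolute value
  \<open>\<bar>a\<^sub>m\<bar> (\<bar>t\<bar> / r) ^ (q ^ m - q ^ n)\<close>, and the ultrametric inequality bounds the sum of the terms with
  \<open>m > n\<close> by a constant times \<open>\<bar>t\<bar>\<close>.
\<close>

section \<open>The Frobenius map of a finite field\<close>

text \<open>
  The polynomial \<open>(X + 1) ^ q - X ^ q - 1\<close> has degree less than \<open>q\<close> and vanishes on all of the
  field with \<open>q\<close> elements.
\<close>

lemma CHAR_dvd_CARD_choose:
  assumes "0 < k" "k < CARD('a::finite_field)"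
  shows "CHAR('a) dvd (CARD('a) choose k)"
proof -
  let ?q = "CARD('a)"
  define p :: "'a poly" where "p = (\<Sum>i=1..<?q. Polynomial.monom (of_nat (?q choose i)) i)"
  have q: "?q = Suc (?q - 1)" "?q > 0"
    by simp_all
  have "poly p b = 0" for b
  proof -
    have "(b + 1) ^ ?q = (\<Sum>i\<le>?q. of_nat (?q choose i) * b ^ i)"
      by (simp add: binomial_ring)
    also have "{..?q} = insert 0 (insert ?q {1..<?q})"
      using q by auto
    also have "(\<Sum>i\<in>\<dots>. of_nat (?q choose i) * b ^ i) = 1 + (b ^ ?q + poly p b)"
      by (simp add: p_def poly_sum poly_monom)
    finally show ?thesis
      by (simp add: finite_field_power_card_eq_same)
  qed
  moreover have "Polynomial.degree p < ?q"
    unfolding p_def using q(2)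
    by (intro degree_sum_less) (auto intro: le_less_trans[OF degree_monom_le])
  ultimately have "p = 0"
    using card_poly_roots_bound[of p] by (cases "p = 0") auto
  hence "Polynomial.coeff p k = 0"
    by simp
  also have "Polynomial.coeff p k = of_nat (?q choose k)"
    using assms by (simp add: p_def coeff_sum)
  finally show ?thesis
    by (simp add: of_nat_eq_0_iff_char_dvd)
qed

text \<open>The inner binomial coefficients are multiples of \<open>CHAR('a)\<close>, hence vanish
  in every ring, finite or not, where \<open>CHAR('a)\<close> is zero.\<close>

lemma add_power_CARD:
  fixes y z :: "'b::comm_ring_1"
  assumes "of_nat CHAR('a::finite_field) = (0 :: 'b)"
  shows "(y + z) ^ CARD('a) = y ^ CARD('a) + z ^ CARD('a)"
proof -
  let ?q = "CARD('a)"
  have choose_eq_0: "of_nat (?q choose k) = (0 :: 'b)" if "0 < k" "k < ?q" for k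
    using CHAR_dvd_CARD_choose[OF that] assms by (auto elim!: dvdE)
  have "(y + z) ^ ?q = (\<Sum>k\<le>?q. of_nat (?q choose k) * y ^ k * z ^ (?q - k))"
    by (rule binomial_ring)
  also have "\<dots> = (\<Sum>k\<in>{0, ?q}. of_nat (?q choose k) * y ^ k * z ^ (?q - k))"
    by (rule sum.mono_neutral_right) (auto simp: choose_eq_0)
  finally show ?thesis
    by (simp add: add.commute)
qed


section \<open>Difference operators\<close>

lemma Delta_diff:
  fixes u v :: "'c::field \<Rightarrow> 'c"
  shows "Delta q x n (\<lambda>s. u s - v s) t = Delta q x n u t - Delta q x n v t"
  by (induction n arbitrary: t) (simp_all add: right_diff_distrib)

lemma Delta_sum:
  fixes f :: "'i \<Rightarrow> 'c::field \<Rightarrow> 'c"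
  shows "Delta q x n (\<lambda>s. \<Sum>i\<in>A. f i s) t = (\<Sum>i\<in>A. Delta q x n (f i) t)"
  by (induction n arbitrary: t) (simp_all add: sum_distrib_left sum_subtractf)

text \<open>Replacing \<open>t\<close> by \<open>x * t\<close> scales \<open>t ^ k\<close> by
  \<open>x ^ k\<close>, so each difference step contributes one factor. With \<open>c\<close> and
  \<open>d\<close> the shape matches a term of the series.\<close>

lemma Delta_monomial:
  fixes c :: "'c::field"
  shows "Delta q x n (\<lambda>s. c * (s ^ k / d)) t = (\<Prod>j<n. x ^ k - x ^ (q ^ j)) * (c * (t ^ k / d))"
  by (induction n arbitrary: t) (simp_all add: algebra_simps power_mult_distrib diff_divide_distrib)


section \<open>Ultrametric estimates\<close>

text \<open>Separates the estimates from the construction of the field; instantiated at the end with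
  \<open>CARD('a)\<close> and the image of \<open>fls_X\<close>.\<close>

locale ultrametric_carlitz =
  fixes absv :: "'c::{field,complete_space} \<Rightarrow> real" and q :: nat and x :: 'c
  assumes dist_eq_absv: "dist y z = absv (y - z)"
    and absv_mult: "absv (y * z) = absv y * absv z"
    and absv_ultrametric: "absv (y + z) \<le> max (absv y) (absv z)"
    and q_ge_2: "q \<ge> 2"
    and absv_x: "absv x = 1 / real q"
    and add_power_q: "(y + z) ^ q = y ^ q + z ^ q"
begin

lemma absv_nonneg: "absv y \<ge> 0"
  using dist_eq_absv[of y 0] by (metis diff_zero zero_le_dist)

lemma absv_eq_0_iff: "absv y = 0 \<longleftrightarrow> y = 0"
  using dist_eq_absv[of y 0] by (metis diff_zero dist_eq_0_iff)

lemma absv_0 [simp]: "absv 0 = 0"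
  by (simp add: absv_eq_0_iff)

lemma absv_1 [simp]: "absv 1 = 1"
  using absv_mult[of 1 1] absv_eq_0_iff[of 1] by simp

lemma absv_minus: "absv (y - z) = absv (z - y)"
  by (metis dist_commute dist_eq_absv)

lemma absv_power: "absv (y ^ k) = absv y ^ k"
  by (induction k) (simp_all add: absv_mult)

lemma absv_prod: "absv (\<Prod>i\<in>A. f i) = (\<Prod>i\<in>A. absv (f i))"
  by (induction A rule: infinite_finite_induct) (simp_all add: absv_mult)

lemma absv_divide: "absv (y / z) = absv y / absv z"
proof (cases "z = 0")
  case False
  thus ?thesis
    using absv_mult[of "y / z" z] absv_eq_0_iff[of z] by (simp add: field_simps)
qed simp

lemma absv_sum_le:
  assumes "\<And>i. i \<in> A \<Longrightarrow> absv (f i) \<le> B" "B \<ge> 0"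
  shows "absv (\<Sum>i\<in>A. f i) \<le> B"
  using assms(1)
proof (induction A rule: infinite_finite_induct)
  case (insert i A)
  thus ?case
    using absv_ultrametric[of "f i" "sum f A"] by fastforce
qed (use assms(2) in auto)

text \<open>Ultrametric triangles are isosceles: in both directions \<open>absv y\<close> is too
  small to exceed the other side.\<close>

lemma absv_diff_eq:
  assumes "absv y < absv z"
  shows "absv (y - z) = absv z"
proof (rule antisym)
  show "absv (y - z) \<le> absv z"
    using absv_ultrametric[of "y - z" 0] absv_ultrametric[of y "-z"] assms absv_minus[of 0 z]
    by simp
  show "absv z \<le> absv (y - z)"
    using absv_ultrametric[of "z - y" y] assms absv_minus[of y z] by simp
qed

text \<open>A block of consecutive terms is no larger than its largest term, so null terms already
  make the partial sums Cauchy.\<close>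

lemma sums_of_absv_tendsto_0:
  assumes "(\<lambda>k. absv (f k)) \<longlonglongrightarrow> 0"
  shows "f sums (\<Sum>k. f k)"
proof -
  have "Cauchy (\<lambda>N. \<Sum>k<N. f k)"
  proof (rule metric_CauchyI)
    fix e :: real assume "e > 0"
    hence "\<forall>\<^sub>F k in sequentially. absv (f k) < e / 2"
      using assms by (intro order_tendstoD) auto
    then obtain M where M: "\<And>k. k \<ge> M \<Longrightarrow> absv (f k) < e / 2"
      by (auto simp: eventually_sequentially)
    have le: "absv (sum f {..<j} - sum f {..<i}) < e" if "M \<le> i" "i \<le> j" for i j
    proof -
      have "sum f {..<j} - sum f {..<i} = sum f {i..<j}"
        using that(2) sum_diff_nat_ivl[of 0 i j f] by (simp add: atLeast0LessThan)
      moreover have "absv (sum f {i..<j}) \<le> e / 2"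
        using M that \<open>e > 0\<close> by (intro absv_sum_le) (auto intro: less_imp_le)
      ultimately show ?thesis
        using \<open>e > 0\<close> by simp
    qed
    show "\<exists>M. \<forall>i\<ge>M. \<forall>j\<ge>M. dist (sum f {..<i}) (sum f {..<j}) < e"
      by (metis le dist_eq_absv absv_minus nat_le_linear)
  qed
  hence "summable f"
    by (auto simp: Cauchy_convergent_iff convergent_def summable_def sums_def)
  then obtain l where "f sums l"
    by (auto simp: summable_def)
  thus ?thesis
    unfolding suminf_def by (metis sums_unique2 theI)
qed

section \<open>Radius of the disc and absolute values of the Carlitz factorials\<close>

definition radius :: real where "radius = real q powr (- 1 / (real q - 1))"

lemma radius_pos: "radius > 0"
  using q_ge_2 by (simp add: radius_def)

text \<open>The value is \<open>absv x\<close>, which thereby becomes a natural power of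
  \<open>radius\<close>.\<close>

lemma radius_power: "radius ^ (q - 1) = 1 / real q"
proof -
  have "radius ^ (q - 1) = radius powr (real q - 1)"
    using q_ge_2 radius_pos by (simp add: of_nat_diff flip: powr_realpow)
  also have "\<dots> = real q powr (- 1)"
    unfolding radius_def powr_powr using q_ge_2 by simp
  finally show ?thesis
    using q_ge_2 by (simp add: powr_minus_divide)
qed

lemma mem_carlitz_disc_iff: "t \<in> carlitz_disc q absv \<longleftrightarrow> absv t \<le> radius"
  by (simp add: carlitz_disc_def radius_def)

lemma x_mult_mem_carlitz_disc:
  assumes "t \<in> carlitz_disc q absv"
  shows "x * t \<in> carlitz_disc q absv"
proof -
  have "absv (x * t) \<le> 1 * absv t"
    unfolding absv_mult using q_ge_2 absv_nonneg by (intro mult_right_mono) (auto simp: absv_x)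
  thus ?thesis
    using assms by (simp add: mem_carlitz_disc_iff)
qed

lemma diff_power_q_power:
  fixes y z :: 'c
  shows "(y - z) ^ (q ^ i) = y ^ (q ^ i) - z ^ (q ^ i)"
proof (induction i)
  case (Suc i)
  \<comment> \<open>Additivity applied to \<open>(v - w) + w\<close> avoids discussing the sign
    \<open>(-1) ^ q\<close>.\<close>
  have diff: "(v - w) ^ q = v ^ q - w ^ q" for v w :: 'c
    using add_power_q[of "v - w" w] by (simp add: algebra_simps)
  show ?case
    unfolding power_Suc2 power_mult Suc.IH by (rule diff)
qed simp

text \<open>By the Frobenius identity the \<open>j\<close>-th factor of \<open>carlitz_D\<close> is
  \<open>x ^ (q ^ n) - x ^ (q ^ (n - j))\<close>; then \<open>j\<close> is replaced by
  \<open>n - j\<close>.\<close>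

lemma carlitz_D_eq: "carlitz_D q x n = (\<Prod>j<n. x ^ (q ^ n) - x ^ (q ^ j))"
proof -
  have "carlitz_D q x n = (\<Prod>j=1..n. x ^ (q ^ n) - x ^ (q ^ (n - j)))"
    unfolding carlitz_D_def bracket_def
    by (intro prod.cong)
       (simp_all add: diff_power_q_power flip: power_mult power_add)
  also have "\<dots> = (\<Prod>j<n. x ^ (q ^ n) - x ^ (q ^ j))"
    by (rule prod.reindex_bij_witness[of _ "\<lambda>j. n - j" "\<lambda>j. n - j"]) auto
  finally show ?thesis .
qed

text \<open>As \<open>absv x < 1\<close>, the lower power \<open>x ^ (q ^ j)\<close> dominates each
  factor, whatever \<open>m\<close> is. The exponents \<open>(q - 1) * q ^ j\<close> add up to
  \<open>q ^ n - 1\<close>.\<close>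

lemma absv_Delta_factor:
  assumes "n \<le> m"
  shows "absv (\<Prod>j<n. x ^ (q ^ m) - x ^ (q ^ j)) = radius ^ (q ^ n - 1)"
proof -
  have factor: "absv (x ^ (q ^ m) - x ^ (q ^ j)) = radius ^ ((q - 1) * q ^ j)" if "j < n" for j
  proof -
    have "q ^ j < q ^ m"
      using that assms q_ge_2 by (intro power_strict_increasing) auto
    hence "absv (x ^ (q ^ m)) < absv (x ^ (q ^ j))"
      using q_ge_2 by (auto simp: absv_power absv_x intro!: power_strict_decreasing)
    thus ?thesis
      unfolding power_mult radius_power by (simp add: absv_diff_eq absv_power absv_x)
  qed
  have "(\<Prod>j<k. radius ^ ((q - 1) * q ^ j)) = radius ^ (q ^ k - 1)" for k
  proof (induction k)
    case (Suc k)
    have "q ^ k - 1 + (q - 1) * q ^ k = q ^ Suc k - 1"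
      using q_ge_2 by (simp add: diff_mult_distrib)
    thus ?case
      using Suc by (simp flip: power_add)
  qed simp
  thus ?thesis
    by (simp add: absv_prod factor)
qed

lemma absv_carlitz_D: "absv (carlitz_D q x n) = radius ^ (q ^ n - 1)"
  by (simp add: carlitz_D_eq absv_Delta_factor)

lemma carlitz_D_nonzero: "carlitz_D q x n \<noteq> 0"
  using absv_carlitz_D[of n] absv_eq_0_iff[of "carlitz_D q x n"] radius_pos by auto

lemma absv_carlitz_quotient:
  assumes "n \<le> m" "t \<noteq> 0"
  shows "absv ((\<Prod>j<n. x ^ (q ^ m) - x ^ (q ^ j)) * (t ^ (q ^ m) / carlitz_D q x m) / t ^ (q ^ n))
           = (absv t / radius) ^ (q ^ m - q ^ n)"
proof -
  have le: "q ^ n \<le> q ^ m" and "1 \<le> q ^ n"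
    using assms(1) q_ge_2 by (auto intro: power_increasing)
  hence "radius ^ (q ^ m - 1) = radius ^ (q ^ m - q ^ n) * radius ^ (q ^ n - 1)"
    "absv t ^ (q ^ m) = absv t ^ (q ^ m - q ^ n) * absv t ^ (q ^ n)"
    by (simp_all flip: power_add)
  thus ?thesis
    using radius_pos assms(2) absv_eq_0_iff[of t]
    by (simp add: absv_mult absv_divide absv_power absv_Delta_factor[OF assms(1)] absv_carlitz_D
        power_divide)
qed

section \<open>Convergence of the series and of its differences on the disc\<close>

lemma carlitz_series_sums:
  assumes "(\<lambda>k. absv (a k)) \<longlonglongrightarrow> 0" "t \<in> carlitz_disc q absv"
  shows "(\<lambda>k. a k * (t ^ (q ^ k) / carlitz_D q x k)) sums carlitz_series q x a t"
  unfolding carlitz_series_def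
proof (rule sums_of_absv_tendsto_0)
  \<comment> \<open>On the disc \<open>absv t ^ (q ^ k)\<close> is at most
    \<open>radius * absv (carlitz_D q x k)\<close>, whose second factor is
    \<open>radius ^ (q ^ k - 1)\<close>.\<close>
  have bound: "absv (a k * (t ^ (q ^ k) / carlitz_D q x k)) \<le> absv (a k) * radius" for k
  proof -
    have "absv t ^ (q ^ k) \<le> radius ^ (q ^ k)"
      using assms(2) by (auto simp: mem_carlitz_disc_iff absv_nonneg intro: power_mono)
    also have "\<dots> = radius * radius ^ (q ^ k - 1)"
      using q_ge_2 by (intro power_minus_mult[symmetric, THEN trans]) (auto simp: mult.commute)
    finally have "absv t ^ (q ^ k) / radius ^ (q ^ k - 1) \<le> radius"
      using radius_pos by (simp add: field_simps)
    thus ?thesis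
      by (simp add: absv_mult absv_divide absv_power absv_carlitz_D absv_nonneg mult_left_mono
          del: times_divide_eq_right)
  qed
  have "(\<lambda>k. absv (a k) * radius) \<longlonglongrightarrow> 0"
    using tendsto_mult_right[OF assms(1), of radius] by simp
  thus "(\<lambda>k. absv (a k * (t ^ (q ^ k) / carlitz_D q x k))) \<longlonglongrightarrow> 0"
    by (rule Lim_null_comparison[rotated])
       (simp add: absv_nonneg bound del: times_divide_eq_right)
qed

text \<open>\<open>Delta\<close> combines finitely many values at points \<open>x ^ i * t\<close>,
  which stay in the disc, so convergence there suffices.\<close>

lemma absv_Delta_tendsto_0:
  assumes "\<And>t. t \<in> carlitz_disc q absv \<Longrightarrow> (\<lambda>N. absv (v N t)) \<longlonglongrightarrow> 0" "t \<in> carlitz_disc q absv"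
  shows "(\<lambda>N. absv (Delta q x n (v N) t)) \<longlonglongrightarrow> 0"
  using assms(2)
proof (induction n arbitrary: t)
  case 0
  thus ?case
    using assms(1) by simp
next
  case (Suc n)
  let ?a = "\<lambda>N. absv (Delta q x n (v N) (x * t))"
  let ?b = "\<lambda>N. absv (x ^ (q ^ n)) * absv (Delta q x n (v N) t)"
  have lim: "?a \<longlonglongrightarrow> 0" "?b \<longlonglongrightarrow> 0"
    using Suc x_mult_mem_carlitz_disc tendsto_mult_left[OF Suc.IH[OF Suc.prems]] by auto
  have bound: "absv (Delta q x (Suc n) (v N) t) \<le> ?a N + ?b N" for N
    using absv_ultrametric[of "Delta q x n (v N) (x * t)" "- (x ^ (q ^ n) * Delta q x n (v N) t)"]
      absv_minus[of 0 "x ^ (q ^ n) * Delta q x n (v N) t"]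
      absv_nonneg[of "Delta q x n (v N) (x * t)"] absv_nonneg[of "x ^ (q ^ n) * Delta q x n (v N) t"]
    by (simp add: absv_mult)
  have "(\<lambda>N. ?a N + ?b N) \<longlonglongrightarrow> 0"
    using tendsto_add[OF lim] by simp
  thus ?case
    by (rule Lim_null_comparison[rotated]) (simp add: absv_nonneg bound del: Delta.simps)
qed

section \<open>Error bound and limit of the difference quotients\<close>

lemma absv_Delta_partial_sum_le:
  assumes a: "\<And>k. absv (a k) \<le> C"
    and t: "t \<in> carlitz_disc q absv" "t \<noteq> 0" and "n < N"
  shows "absv (Delta q x n (\<lambda>s. \<Sum>k<N. a k * (s ^ (q ^ k) / carlitz_D q x k)) t / t ^ (q ^ n) - a n)
           \<le> C * (absv t / radius)"
proof -
  \<comment> \<open>The multiplier of \<open>a k\<close>: zero for \<open>k < n\<close>, where the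
    factor \<open>j = k\<close> vanishes, one for \<open>k = n\<close>, and of size at most
    \<open>absv t / radius\<close> for \<open>k > n\<close>.\<close>
  define g where
    "g k = (\<Prod>j<n. x ^ (q ^ k) - x ^ (q ^ j)) * (t ^ (q ^ k) / carlitz_D q x k) / t ^ (q ^ n)" for k
  have C: "C \<ge> 0"
    using a[of 0] absv_nonneg[of "a 0"] by linarith
  have ratio: "0 \<le> absv t / radius" "absv t / radius \<le> 1"
    using t radius_pos absv_nonneg[of t] by (auto simp: mem_carlitz_disc_iff)
  have "Delta q x n (\<lambda>s. \<Sum>k<N. a k * (s ^ (q ^ k) / carlitz_D q x k)) t / t ^ (q ^ n)
          = (\<Sum>k<N. a k * g k)"
    unfolding Delta_sum Delta_monomial g_def by (simp add: sum_divide_distrib mult_ac)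
  also have "\<dots> = a n * g n + (\<Sum>k\<in>{..<N} - {n}. a k * g k)"
    using \<open>n < N\<close> by (intro sum.remove) auto
  also have "g n = 1"
    using t carlitz_D_nonzero[of n] by (simp add: g_def flip: carlitz_D_eq)
  finally have eq: "Delta q x n (\<lambda>s. \<Sum>k<N. a k * (s ^ (q ^ k) / carlitz_D q x k)) t / t ^ (q ^ n) - a n
          = (\<Sum>k\<in>{..<N} - {n}. a k * g k)"
    by simp
  have "absv (a k * g k) \<le> C * (absv t / radius)" if "k \<noteq> n" for k
  proof (cases "k < n")
    case True
    hence "g k = 0"
      by (auto simp: g_def)
    thus ?thesis
      using mult_nonneg_nonneg[OF C ratio(1)] by simp
  next
    case False
    hence "q ^ n < q ^ k"
      using that q_ge_2 by (intro power_strict_increasing) auto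
    hence "(absv t / radius) ^ (q ^ k - q ^ n) \<le> (absv t / radius) ^ 1"
      using ratio by (intro power_decreasing) auto
    moreover have "absv (g k) = (absv t / radius) ^ (q ^ k - q ^ n)"
      using False t unfolding g_def by (intro absv_carlitz_quotient) auto
    ultimately show ?thesis
      unfolding absv_mult using a[of k] C absv_nonneg[of "g k"] by (intro mult_mono) auto
  qed
  thus ?thesis
    unfolding eq using mult_nonneg_nonneg[OF C ratio(1)] by (intro absv_sum_le) blast+
qed

text \<open>The bound for partial sums is uniform in \<open>N\<close>, so it survives the
  limit.\<close>

lemma absv_Delta_quotient_diff_le:
  assumes u: "in_H q x absv u a" and a: "\<And>k. absv (a k) \<le> C"
    and t: "t \<in> carlitz_disc q absv" "t \<noteq> 0"
  shows "absv (Delta q x n u t / t ^ (q ^ n) - a n) \<le> C * (absv t / radius)"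
proof -
  define S where "S N s = (\<Sum>k<N. a k * (s ^ (q ^ k) / carlitz_D q x k))" for N s
  define z where "z = Delta q x n u t / t ^ (q ^ n) - a n"
  define w where "w N = Delta q x n (S N) t / t ^ (q ^ n) - a n" for N
  have "(\<lambda>N. absv (u s - S N s)) \<longlonglongrightarrow> 0" if s: "s \<in> carlitz_disc q absv" for s
  proof -
    have "(\<lambda>N. S N s) \<longlonglongrightarrow> u s"
      using u carlitz_series_sums[of a s] s by (simp add: in_H_def S_def sums_def)
    thus ?thesis
      unfolding tendsto_dist_iff[of "\<lambda>N. S N s"] by (simp add: dist_eq_absv absv_minus)
  qed
  hence "(\<lambda>N. absv (Delta q x n u t - Delta q x n (S N) t)) \<longlonglongrightarrow> 0"
    using absv_Delta_tendsto_0[of "\<lambda>N s. u s - S N s" t n] t by (simp add: Delta_diff)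
  hence "(\<lambda>N. absv (Delta q x n u t - Delta q x n (S N) t) / absv (t ^ (q ^ n))) \<longlonglongrightarrow> 0"
    by (intro tendsto_divide_zero)
  hence lim: "(\<lambda>N. absv (z - w N)) \<longlonglongrightarrow> 0"
    by (simp add: z_def w_def absv_divide flip: diff_divide_distrib)
  have C: "0 \<le> C * (absv t / radius)"
    using a[of 0] absv_nonneg[of "a 0"] absv_nonneg[of t] radius_pos by auto
  show ?thesis
  proof (rule ccontr)
    assume "\<not> ?thesis"
    hence z: "C * (absv t / radius) < absv z"
      by (simp add: z_def)
    \<comment> \<open>Of the two summands of \<open>z = (z - w N) + w N\<close>, the second is too
      small to reach \<open>absv z\<close>; yet the first tends to 0.\<close>
    have "absv z \<le> absv (z - w N)" if "n < N" for N
    proof -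
      have "absv (w N) \<le> C * (absv t / radius)"
        using absv_Delta_partial_sum_le[OF a t that] by (simp only: w_def S_def[abs_def])
      thus ?thesis
        using absv_ultrametric[of "z - w N" "w N"] z by simp
    qed
    hence "\<forall>\<^sub>F N in sequentially. absv z \<le> absv (z - w N)"
      by (rule eventually_mono[OF eventually_gt_at_top[of n]])
    hence "absv z \<le> 0"
      by (intro tendsto_lowerbound[OF lim]) auto
    thus False
      using z C by simp
  qed
qed

text \<open>Null coefficients are bounded, so the error is at most a constant times
  \<open>absv t\<close>.\<close>

lemma Delta_quotient_tendsto:
  assumes u: "in_H q x absv u a"
  shows "((\<lambda>t. Delta q x n u t / t ^ (q ^ n)) \<longlongrightarrow> a n) (at 0 within carlitz_disc q absv)"
proof -
  have "Bseq (\<lambda>k. absv (a k))"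
    using u convergent_imp_Bseq[OF convergentI, of "\<lambda>k. absv (a k)" 0] by (simp add: in_H_def)
  then obtain C where "\<forall>k. norm (absv (a k)) \<le> C"
    by (rule BseqE)
  hence C: "absv (a k) \<le> C" for k
    by (simp add: absv_nonneg)
  \<comment> \<open>The limit is taken for \<open>dist t 0\<close>, known to be continuous, and then
    rewritten for \<open>absv t\<close>.\<close>
  have "((\<lambda>t. C * (dist t 0 / radius)) \<longlongrightarrow> C * (dist 0 (0::'c) / radius))
          (at 0 within carlitz_disc q absv)"
    by (intro tendsto_intros) (use radius_pos in auto)
  hence lim: "((\<lambda>t. C * (absv t / radius)) \<longlongrightarrow> 0) (at 0 within carlitz_disc q absv)"
    by (simp add: dist_eq_absv)
  have "\<forall>\<^sub>F t in at 0 within carlitz_disc q absv.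
          dist (Delta q x n u t / t ^ (q ^ n)) (a n) \<le> C * (absv t / radius)"
    unfolding eventually_at_filter dist_eq_absv
    using absv_Delta_quotient_diff_le[OF u C] by simp
  hence "((\<lambda>t. dist (Delta q x n u t / t ^ (q ^ n)) (a n)) \<longlongrightarrow> 0) (at 0 within carlitz_disc q absv)"
    by (intro Lim_null_comparison[OF _ lim]) simp
  thus ?thesis
    by (rule iffD2[OF tendsto_dist_iff])
qed

end


section \<open>The completed algebraic closure\<close>

context completed_algebraic_closure
begin

lemma emb_0: "emb 0 = 0"
  using emb_add[of 0 0] by (metis add.right_neutral add_left_cancel)

lemma emb_of_nat: "emb (of_nat k) = of_nat k"
  by (induction k) (simp_all add: emb_0 emb_add emb_one)

lemma ultrametric_carlitz: "ultrametric_carlitz absv CARD('a) (emb (to_ac fls_X))"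
proof
  have "card {0, 1 :: 'a} \<le> CARD('a)"
    by (rule card_mono) auto
  thus "2 \<le> CARD('a)"
    by simp
  show "absv (emb (to_ac fls_X)) = 1 / real CARD('a)"
    by (simp add: absv_extends fls_abs_def power_int_minus divide_inverse)
  \<comment> \<open>The characteristic passes from \<open>'a\<close> to its Laurent series and their
    closure, then along \<open>emb\<close> to \<open>'c\<close>.\<close>
  have "of_nat CHAR('a) = (0 :: 'a fls alg_closure)"
    by (simp add: of_nat_eq_0_iff_char_dvd)
  hence "of_nat CHAR('a) = (0 :: 'c)"
    by (metis emb_0 emb_of_nat)
  thus "(y + z) ^ CARD('a) = y ^ CARD('a) + z ^ CARD('a)" for y z :: 'c
    by (rule add_power_CARD)
qed (rule dist_eq_absv absv_mult absv_ultrametric)+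

end

theorem theorem1:
  fixes emb :: "'a::finite_field fls alg_closure \<Rightarrow> 'c::{field,complete_space}"
    and absv :: "'c \<Rightarrow> real"
    and q :: nat and x :: 'c
    and u :: "'c \<Rightarrow> 'c" and a :: "nat \<Rightarrow> 'c" and n :: nat
  assumes "completed_algebraic_closure emb absv"
    and "q = CARD('a)"
    and "x = emb (to_ac fls_X)"
    and "in_H q x absv u a"
  shows "((\<lambda>t. Delta q x n u t / t ^ (q ^ n)) \<longlongrightarrow> a n) (at 0 within carlitz_disc q absv)"
proof -
  interpret ultrametric_carlitz absv q x
    unfolding assms(2,3) by (rule completed_algebraic_closure.ultrametric_carlitz[OF assms(1)])
  show ?thesis
    using assms(4) by (rule Delta_quotient_tendsto)
qed

end
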